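(* Let $k=k(n)\geq 2$ and $l=l(n)\geq 0$ be integer functions and $\rho=\rho(n)\in(0,1]$ a real function such that $d=n-2k-2l+2\geq 2$. Put $t=\left\lceil\binom{k+l}{k}/(d-1)\right\rceil$. If $$2(k+l)(\ln n+1)+2t(1+\ln(d-1))-\rho t^2\longrightarrow-\infty \quad\text{as } n\to\infty,$$ then almost surely $\chi(\operatorname{SG}_{n,k}(\rho))\geq d$.
   Context: A subset $A\subseteq[n]$ is stable if for all distinct $i,j\in A$ we have $2\leq|i-j|\leq n-2$. The Schrijver graph $\operatorname{SG}_{n,k}$ has as vertices the stable $k$-subsets of $[n]$, two being adjacent iff they are disjoint. $\operatorname{SG}_{n,k}(\rho)$ is the random spanning subgraph containing each edge of $\operatorname{SG}_{n,k}$ independently with probability $\rho$. $\chi$ denotes chromatic number. "Almost surely" means with probability tending to $1$ as $n\to\infty$. *)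

theory Defs
  imports "HOL-Probability.Probability" "HOL-Probability.Product_PMF"
begin

text \<open>A graph is a pair of a vertex set and a set of edges; an edge is a two-element set of vertices.\<close>

type_synonym 'a graph = "'a set \<times> 'a set set"

definition verts :: "'a graph \<Rightarrow> 'a set" where
  "verts G = fst G"

definition edges :: "'a graph \<Rightarrow> 'a set set" where
  "edges G = snd G"

definition proper_coloring :: "'a graph \<Rightarrow> nat \<Rightarrow> ('a \<Rightarrow> nat) \<Rightarrow> bool" where
  "proper_coloring G c f \<longleftrightarrow>
     f ` verts G \<subseteq> {..<c} \<and>
     (\<forall>u\<in>verts G. \<forall>v\<in>verts G. {u, v} \<in> edges G \<longrightarrow> f u \<noteq> f v)"

text \<open>The minimum exists for finite loopless graphs, the only ones considered here.\<close>

definition chromatic_number :: "'a graph \<Rightarrow> nat" where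
  "chromatic_number G = (LEAST c. \<exists>f. proper_coloring G c f)"

definition stable :: "nat \<Rightarrow> nat set \<Rightarrow> bool" where
  "stable n A \<longleftrightarrow>
     (\<forall>i\<in>A. \<forall>j\<in>A. i \<noteq> j \<longrightarrow>
        2 \<le> \<bar>int i - int j\<bar> \<and> \<bar>int i - int j\<bar> \<le> int n - 2)"

definition schrijver_verts :: "nat \<Rightarrow> nat \<Rightarrow> nat set set" where
  "schrijver_verts n k = {A. A \<subseteq> {1..n} \<and> card A = k \<and> stable n A}"

text \<open>The condition \<open>A \<noteq> B\<close> is automatic for \<open>k \<ge> 1\<close>; it only excludes a loop at
  the empty set when \<open>k = 0\<close>.\<close>

definition schrijver_graph :: "nat \<Rightarrow> nat \<Rightarrow> nat set graph" where
  "schrijver_graph n k =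
     (schrijver_verts n k,
      {{A, B} | A B. A \<in> schrijver_verts n k \<and> B \<in> schrijver_verts n k \<and>
                     A \<noteq> B \<and> A \<inter> B = {}})"

text \<open>One independent Bernoulli variable per edge of \<open>G\<close> (meaningful for finite edge sets)
  decides whether the edge is kept; all vertices are kept.\<close>

definition random_spanning_subgraph :: "'a graph \<Rightarrow> real \<Rightarrow> 'a graph pmf" where
  "random_spanning_subgraph G p =
     map_pmf (\<lambda>keep. (verts G, {e \<in> edges G. keep e}))
       (Pi_pmf (edges G) False (\<lambda>_. bernoulli_pmf p))"

end

theory Submission
  imports Defs
begin

text \<open>
  Let \<open>m = k + l\<close> and suppose the random subgraph is coloured with \<open>d - 1\<close> colours. Every \<open>k\<close>-subset of a
  stable \<open>m\<close>-set \<open>A\<close> is a vertex, so some colour occurs on at least \<open>t\<close> of them; give \<open>A\<close> this colour.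
  By Schrijver's theorem \<open>SG n m\<close> is not \<open>(d - 1)\<close>-colourable, so two disjoint stable \<open>m\<close>-sets get the
  same colour, and all \<open>t^2\<close> edges between \<open>t\<close>-families of \<open>k\<close>-subsets of the two are missing. A union
  bound over these configurations finishes the proof.

  Schrijver's bound follows from the octahedral Tucker lemma, which comes from Ky Fan's parity
  count of positive alternating flags. A sign vector whose longest alternating subsequence is
  shorter than \<open>2m\<close> is labelled by that length, signed by the first term; otherwise both of its sign
  classes contain stable \<open>m\<close>-sets, and it is labelled by the largest colour occurring on one of them.
  That colour is never the smallest one, which saves the label needed for the sharp bound.
\<close>

section \<open>Alternating sets of integers\<close>

text \<open>Listed by increasing absolute value, the elements alternate in sign, the first being positive
  iff \<open>b\<close>.\<close>

definition alternating :: "bool \<Rightarrow> int set \<Rightarrow> bool" where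
  "alternating b L \<longleftrightarrow> 0 \<notin> L \<and> inj_on abs L \<and>
     (\<forall>x\<in>L. x > 0 \<longleftrightarrow> (b \<longleftrightarrow> even (card {y\<in>L. \<bar>y\<bar> < \<bar>x\<bar>})))"

lemma alternating_empty [simp]: "alternating b {}"
  by (simp add: alternating_def)

text \<open>A new element of smallest absolute value raises every other rank by one and so flips all
  parities. This recursion drives the inductions ranked by \<open>- \<bar>x\<bar>\<close>, which
  insert elements in order of decreasing absolute value.\<close>

lemma alternating_insert_min:
  assumes "finite L" and less: "\<And>y. y \<in> L \<Longrightarrow> \<bar>x\<bar> < \<bar>y\<bar>"
  shows "alternating b (insert x L) \<longleftrightarrow> x \<noteq> 0 \<and> (x > 0 \<longleftrightarrow> b) \<and> alternating (\<not> b) L"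
proof -
  have x: "{y \<in> insert x L. \<bar>y\<bar> < \<bar>x\<bar>} = {}"
    using less by force
  have xL: "x \<notin> L" using less by blast
  have cardL: "card {y \<in> insert x L. \<bar>y\<bar> < \<bar>z\<bar>} = Suc (card {y\<in>L. \<bar>y\<bar> < \<bar>z\<bar>})" if "z \<in> L" for z
  proof -
    have "{y \<in> insert x L. \<bar>y\<bar> < \<bar>z\<bar>} = insert x {y\<in>L. \<bar>y\<bar> < \<bar>z\<bar>}"
      using less[OF that] by auto
    then show ?thesis using assms(1) xL by simp
  qed
  have inj: "inj_on abs (insert x L) \<longleftrightarrow> inj_on abs L"
    using less by force
  have "0 \<notin> L" using less by force
  have big: "(\<forall>z\<in>insert x L. z > 0 \<longleftrightarrow> (b \<longleftrightarrow> even (card {y \<in> insert x L. \<bar>y\<bar> < \<bar>z\<bar>}))) \<longleftrightarrow>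
      (x > 0 \<longleftrightarrow> b) \<and> (\<forall>z\<in>L. z > 0 \<longleftrightarrow> (\<not> b \<longleftrightarrow> even (card {y\<in>L. \<bar>y\<bar> < \<bar>z\<bar>})))"
  proof -
    have aux: "(\<forall>z\<in>insert x L. P z) \<longleftrightarrow> R \<and> (\<forall>z\<in>L. Q z)"
      if "P x \<longleftrightarrow> R" "\<And>z. z \<in> L \<Longrightarrow> P z \<longleftrightarrow> Q z" for P Q R
      using that by blast
    show ?thesis
    proof (rule aux)
      show "(x > 0 \<longleftrightarrow> (b \<longleftrightarrow> even (card {y \<in> insert x L. \<bar>y\<bar> < \<bar>x\<bar>}))) \<longleftrightarrow> (x > 0 \<longleftrightarrow> b)"
        unfolding x by simp
    qed (cases b; simp add: cardL del: insert_iff)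
  qed
  show ?thesis
    unfolding alternating_def inj big using \<open>0 \<notin> L\<close>
    by (cases "x = 0"; cases "(0 < x) = b"; simp)
qed

lemma alternating_uminus: "alternating b (uminus ` L) \<longleftrightarrow> alternating (\<not> b) L"
proof -
  have "{y \<in> uminus ` L. \<bar>y\<bar> < \<bar>x\<bar>} = uminus ` {y\<in>L. \<bar>y\<bar> < \<bar>x\<bar>}" for x :: int
    by auto
  then have "card {y \<in> uminus ` L. \<bar>y\<bar> < \<bar>x\<bar>} = card {y\<in>L. \<bar>y\<bar> < \<bar>x\<bar>}" for x :: int
    by (simp add: card_image)
  moreover have "inj_on abs (uminus ` L) \<longleftrightarrow> inj_on abs L"
    by (simp add: inj_on_def)
  ultimately show ?thesis
    unfolding alternating_def by (auto simp: less_le)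
qed

text \<open>If \<open>L\<close> is nonempty and alternates with first sign \<open>b\<close>, only
  deleting the last element keeps the pattern; with the opposite first sign, only deleting the first
  one produces it. Any other \<open>L\<close> has no good deletion, or two, coming from one repeated
  sign. The empty set alternates in both senses and has no deletions, hence the exclusive
  or.\<close>

lemma odd_card_alternating_deletions:
  assumes "finite L" "0 \<notin> L" "inj_on abs L"
  shows "odd (card {y\<in>L. alternating b (L - {y})}) \<longleftrightarrow> alternating b L \<noteq> alternating (\<not> b) L"
  using assms
proof (induction arbitrary: b rule: finite_ranking_induct[where f = "\<lambda>x::int. - \<bar>x\<bar>"])
  case empty
  then show ?case by simp
next
  case (insert x S)
  show ?case
  proof (cases "x \<in> S")
    case True
    then show ?thesis using insert by (simp add: insert_absorb)
  next
    case False
    have less: "\<bar>x\<bar> < \<bar>y\<bar>" if "y \<in> S" for y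
    proof -
      have "\<bar>x\<bar> \<noteq> \<bar>y\<bar>" using that False insert.prems(2) by (auto simp: inj_on_def)
      with insert.hyps(2)[OF that] show ?thesis by simp
    qed
    have IH: "odd (card {y\<in>S. alternating b (S - {y})}) \<longleftrightarrow> alternating b S \<noteq> alternating (\<not> b) S" for b
      using insert.IH insert.prems by simp
    have x0: "x \<noteq> 0" using insert.prems by auto
    have ins: "alternating b (insert x T) \<longleftrightarrow> (x > 0 \<longleftrightarrow> b) \<and> alternating (\<not> b) T" if "T \<subseteq> S" for b T
      using alternating_insert_min[of T x b] that less x0 finite_subset[OF that insert.hyps(1)] by blast
    \<comment> \<open>Deleting \<open>x\<close> leaves \<open>S\<close>. Any other deletion keeps
      \<open>x\<close> in front, which forces its sign to be \<open>b\<close> and leaves a deletion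
      from \<open>S\<close> with the sign flipped.\<close>
    have "{y\<in>insert x S. alternating b (insert x S - {y})} =
        (if alternating b S then {x} else {}) \<union>
        (if x > 0 \<longleftrightarrow> b then {y\<in>S. alternating (\<not> b) (S - {y})} else {})"
    proof -
      have "insert x S - {x} = S" using False by blast
      moreover have "alternating b (insert x S - {y}) \<longleftrightarrow> (x > 0 \<longleftrightarrow> b) \<and> alternating (\<not> b) (S - {y})"
        if "y \<in> S" for y
      proof -
        have "insert x S - {y} = insert x (S - {y})" using that False by blast
        then show ?thesis using ins[of "S - {y}" b] by auto
      qed
      ultimately show ?thesis using False by (auto split: if_splits)
    qed
    then have "card {y\<in>insert x S. alternating b (insert x S - {y})} =
        (if alternating b S then 1 else 0) +
        (if x > 0 \<longleftrightarrow> b then card {y\<in>S. alternating (\<not> b) (S - {y})} else 0)"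
      using False insert.hyps(1) by (auto simp: card_insert_if)
    then show ?thesis using IH[of "\<not> b"] ins[of S] by auto
  qed
qed

text \<open>Labels along a flag may coincide. With injectivity demanded, a repeated label spoils
  alternation instead of vanishing in the image.\<close>

definition alternating_on :: "bool \<Rightarrow> ('i \<Rightarrow> int) \<Rightarrow> 'i set \<Rightarrow> bool" where
  "alternating_on b h I \<longleftrightarrow> inj_on h I \<and> alternating b (h ` I)"

lemma alternating_on_cong:
  assumes "\<And>i. i \<in> I \<Longrightarrow> g i = h i"
  shows "alternating_on b g I \<longleftrightarrow> alternating_on b h I"
  unfolding alternating_on_def using assms inj_on_cong[of I g h] image_cong[of I I g h] by auto

lemma alternating_on_uminus:
  "alternating_on b (\<lambda>i. - h i) I \<longleftrightarrow> alternating_on (\<not> b) h I"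
proof -
  have "(\<lambda>i. - h i) ` I = uminus ` h ` I" by auto
  then show ?thesis
    by (simp add: alternating_on_def alternating_uminus inj_on_def)
qed

text \<open>For injective \<open>h\<close> this is the count for the set of labels. If
  \<open>h i = h j\<close> with \<open>i \<noteq> j\<close>, only deleting \<open>i\<close> or
  \<open>j\<close> can restore injectivity, and both deletions leave the same labels, so the count
  is 0 or 2.\<close>

lemma odd_card_alternating_on_deletions:
  assumes fin: "finite I" and comp: "\<And>i j. i \<in> I \<Longrightarrow> j \<in> I \<Longrightarrow> h i \<noteq> - h j"
  shows "odd (card {i\<in>I. alternating_on b h (I - {i})}) \<longleftrightarrow>
         alternating_on b h I \<noteq> alternating_on (\<not> b) h I"
proof (cases "inj_on h I")
  case True
  have "h ` {i\<in>I. alternating_on b h (I - {i})} = {y\<in>h ` I. alternating b (h ` I - {y})}"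
  proof -
    have "h ` (I - {i}) = h ` I - {h i}" if "i \<in> I" for i
      using True that by (auto simp: inj_on_def)
    moreover have "inj_on h (I - {i})" for i
      using True by (rule inj_on_subset) auto
    ultimately show ?thesis unfolding alternating_on_def by auto
  qed
  then have "card {i\<in>I. alternating_on b h (I - {i})} = card {y\<in>h ` I. alternating b (h ` I - {y})}"
    using True by (metis (no_types, lifting) card_image inj_on_subset mem_Collect_eq subsetI)
  \<comment> \<open>The case \<open>i = j\<close> of \<open>comp\<close> rules out the label
    0.\<close>
  moreover have "0 \<notin> h ` I" using comp by force
  moreover have "inj_on abs (h ` I)"
    using comp by (auto simp: inj_on_def abs_eq_iff)
  ultimately show ?thesis
    using odd_card_alternating_deletions[of "h ` I" b] fin True by (simp add: alternating_on_def)
next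
  case False
  then obtain i j where ij: "i \<in> I" "j \<in> I" "i \<noteq> j" "h i = h j"
    by (auto simp: inj_on_def)
  have only: "r = i \<or> r = j" if "alternating_on b h (I - {r})" for r
    using ij that unfolding alternating_on_def inj_on_def by blast
  have "alternating_on b h (I - {i}) \<longleftrightarrow> alternating_on b h (I - {j})"
  proof -
    have "h ` I \<subseteq> h ` (I - {p})" if "p \<in> I" "q \<in> I" "p \<noteq> q" "h p = h q" for p q
    proof
      fix y assume "y \<in> h ` I"
      then obtain x where "x \<in> I" "y = h x" by blast
      then show "y \<in> h ` (I - {p})" using that by (cases "x = p") auto
    qed
    from this[of i j] this[of j i] ij have "h ` (I - {i}) = h ` (I - {j})"
      by auto
    moreover have "card (I - {i}) = card (I - {j})" using ij fin by simp
    ultimately have "inj_on h (I - {i}) \<longleftrightarrow> inj_on h (I - {j})"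
      using fin by (metis card_image eq_card_imp_inj_on finite_Diff)
    then show ?thesis
      using \<open>h ` (I - {i}) = h ` (I - {j})\<close> by (simp add: alternating_on_def)
  qed
  then have "{r\<in>I. alternating_on b h (I - {r})} =
      (if alternating_on b h (I - {i}) then {i, j} else {})"
    using ij by (auto dest: only)
  then have "even (card {r\<in>I. alternating_on b h (I - {r})})"
    using ij(3) by auto
  then show ?thesis using False by (auto simp: alternating_on_def)
qed

section \<open>The octahedral Tucker lemma\<close>

lemma alternating_sign_unique:
  assumes "L \<noteq> {}" "alternating True L"
  shows "\<not> alternating False L"
  using assms unfolding alternating_def by blast

lemma even_card_involution:
  assumes "finite S"
    and "\<And>x. x \<in> S \<Longrightarrow> f x \<in> S" "\<And>x. x \<in> S \<Longrightarrow> f (f x) = x" "\<And>x. x \<in> S \<Longrightarrow> f x \<noteq> x"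
  shows "even (card S)"
  using assms
proof (induction S rule: finite_psubset_induct)
  case (psubset S)
  show ?case
  proof (cases "S = {}")
    case False
    then obtain x where x: "x \<in> S" by blast
    define T where "T = S - {x, f x}"
    have "even (card T)"
    proof (rule psubset.IH)
      show "T \<subset> S" using x by (auto simp: T_def)
      show "f y \<in> T" if "y \<in> T" for y
        using that psubset.prems x unfolding T_def by (metis Diff_iff insert_iff singletonD)
    qed (use psubset.prems in \<open>auto simp: T_def\<close>)
    moreover have "S = insert x (insert (f x) T)" "x \<notin> insert (f x) T" "f x \<notin> T"
      using x psubset.prems by (auto simp: T_def) metis
    moreover have "finite T" using psubset.hyps by (simp add: T_def)
    ultimately show ?thesis by (metis card_insert_disjoint even_Suc finite_insert)
  qed simp
qed

section \<open>Sign vectors and maximal flags\<close>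

text \<open>A nonzero sign vector in \<open>{+, -, 0}^n\<close> is encoded as the set of its signed support elements.\<close>

definition signed_sets :: "nat \<Rightarrow> int set set" where
  "signed_sets n = {X. X \<noteq> {} \<and> X \<subseteq> {- int n..int n} - {0} \<and> (\<forall>x\<in>X. - x \<notin> X)}"

lemma uminus_signed_sets: "X \<in> signed_sets n \<Longrightarrow> uminus ` X \<in> signed_sets n"
  unfolding signed_sets_def by auto

text \<open>A maximal chain of sign vectors on \<open>{1..k}\<close>, listed by the signed elements added one at a
  time; the members of the chain are the sets of the nonempty prefixes.\<close>

definition signed_perms :: "nat \<Rightarrow> int list set" where
  "signed_perms k = {w. length w = k \<and> abs ` set w = {1..int k}}"

lemma finite_signed_perms: "finite (signed_perms k)"
proof (rule finite_subset)
  show "signed_perms k \<subseteq> {w. set w \<subseteq> {- int k..int k} \<and> length w = k}"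
  proof
    fix w assume w: "w \<in> signed_perms k"
    have "x \<in> {- int k..int k}" if "x \<in> set w" for x
    proof -
      have "\<bar>x\<bar> \<in> {1..int k}" using w that unfolding signed_perms_def by blast
      then show ?thesis by auto
    qed
    with w show "w \<in> {w. set w \<subseteq> {- int k..int k} \<and> length w = k}"
      unfolding signed_perms_def by blast
  qed
  show "finite {w. set w \<subseteq> {- int k..int k} \<and> length w = k}"
    by (rule finite_lists_length_eq) simp
qed

lemma signed_perms_distinct:
  assumes "w \<in> signed_perms k"
  shows "distinct (map abs w)"
proof (rule card_distinct)
  show "card (set (map abs w)) = length (map abs w)"
    using assms unfolding signed_perms_def by simp
qed

lemma signed_perms_nth_nonzero:
  assumes "w \<in> signed_perms k" "i < k"
  shows "w ! i \<noteq> 0"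
proof -
  have "\<bar>w ! i\<bar> \<in> {1..int k}"
    using assms unfolding signed_perms_def by (metis (mono_tags) imageI mem_Collect_eq nth_mem)
  then show ?thesis by auto
qed

lemma map_uminus_signed_perms: "w \<in> signed_perms k \<Longrightarrow> map uminus w \<in> signed_perms k"
  unfolding signed_perms_def by (simp add: image_image)

lemma signed_perms_prefix:
  assumes "w \<in> signed_perms k" "k \<le> n" "i < k"
  shows "set (take (Suc i) w) \<in> signed_sets n"
proof -
  have range: "x \<in> {- int n..int n} - {0}" if "x \<in> set w" for x
  proof -
    have "\<bar>x\<bar> \<in> {1..int k}" using assms that unfolding signed_perms_def by blast
    then show ?thesis using assms(2) by auto
  qed
  have "inj_on abs (set w)"
    using signed_perms_distinct[OF assms(1)] by (simp add: distinct_map)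
  then have "- x \<notin> set w" if "x \<in> set w" for x
    using that range[OF that] inj_onD[of abs "set w" x "- x"] by auto
  moreover have "set (take (Suc i) w) \<noteq> {}"
    using assms unfolding signed_perms_def by auto
  ultimately show ?thesis
    using range unfolding signed_sets_def by (blast dest: in_set_takeD)
qed

text \<open>With the next lemma, this identifies the flags on \<open>j\<close> coordinates with the
  flags on \<open>Suc j\<close> coordinates whose last step adds the new coordinate with positive
  sign: the equator as the boundary of a hemisphere.\<close>

lemma signed_perms_append:
  assumes "v \<in> signed_perms j"
  shows "v @ [int (Suc j)] \<in> signed_perms (Suc j)"
  using assms unfolding signed_perms_def by auto

lemma signed_perms_take:
  assumes "w \<in> signed_perms (Suc j)" "w ! j = int (Suc j)"
  shows "take j w \<in> signed_perms j" "w = take j w @ [int (Suc j)]"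
proof -
  have len: "length w = Suc j" using assms unfolding signed_perms_def by simp
  then show w: "w = take j w @ [int (Suc j)]"
    using assms(2) by (metis lessI take_Suc_conv_app_nth take_all_iff le_refl)
  have "distinct (map abs (take j w) @ [int (Suc j)])"
    using signed_perms_distinct[OF assms(1)] by (subst (asm) w) simp
  then have "int (Suc j) \<notin> abs ` set (take j w)" by simp
  moreover have "insert (int (Suc j)) (abs ` set (take j w)) = {1..int (Suc j)}"
    using assms(1) unfolding signed_perms_def by (subst (asm) w) simp
  ultimately have "abs ` set (take j w) = {1..int (Suc j)} - {int (Suc j)}" by blast
  also have "\<dots> = {1..int j}" by auto
  finally show "take j w \<in> signed_perms j"
    using len unfolding signed_perms_def by simp
qed

text \<open>The labelling is antipodal and has no complementary pair along an inclusion. The case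
  \<open>X = Y\<close> of the second condition makes all labels nonzero.\<close>

locale tucker_labelling =
  fixes n :: nat and lam :: "int set \<Rightarrow> int"
  assumes lam_uminus: "X \<in> signed_sets n \<Longrightarrow> lam (uminus ` X) = - lam X"
    and lam_not_opposite: "X \<in> signed_sets n \<Longrightarrow> Y \<in> signed_sets n \<Longrightarrow> X \<subseteq> Y \<Longrightarrow> lam X \<noteq> - lam Y"
begin

text \<open>Step \<open>i\<close> is the prefix of length \<open>Suc i\<close>, because the empty
  prefix is not a nonzero sign vector.\<close>

definition flag_label :: "int list \<Rightarrow> nat \<Rightarrow> int" where
  "flag_label w i = lam (set (take (Suc i) w))"

definition alternating_flag :: "bool \<Rightarrow> int list \<Rightarrow> bool" where
  "alternating_flag b w \<longleftrightarrow> alternating_on b (flag_label w) {..<length w}"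

text \<open>Exactly two maximal flags share the facet obtained by omitting step \<open>i\<close>, and this map exchanges
  them.\<close>

definition swap_flag :: "int list \<times> nat \<Rightarrow> int list \<times> nat" where
  "swap_flag = (\<lambda>(w, i). (if Suc i < length w then w[i := w ! Suc i, Suc i := w ! i]
                           else w[i := - w ! i], i))"

lemma flag_label_not_opposite:
  assumes "w \<in> signed_perms k" "k \<le> n" "i < k" "i' < k"
  shows "flag_label w i \<noteq> - flag_label w i'"
proof -
  have "set (take (Suc i) w) \<subseteq> set (take (Suc i') w) \<or> set (take (Suc i') w) \<subseteq> set (take (Suc i) w)"
    by (metis nat_le_linear set_take_subset_set_take)
  then show ?thesis
    using lam_not_opposite signed_perms_prefix assms unfolding flag_label_def
    by (metis minus_equation_iff)
qed

lemma flag_label_uminus: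
  assumes "w \<in> signed_perms k" "k \<le> n" "i < k"
  shows "flag_label (map uminus w) i = - flag_label w i"
  using lam_uminus[OF signed_perms_prefix[OF assms]] by (simp add: flag_label_def take_map)

lemma alternating_flag_uminus:
  assumes "w \<in> signed_perms k" "k \<le> n"
  shows "alternating_flag b (map uminus w) \<longleftrightarrow> alternating_flag (\<not> b) w"
proof -
  have "length w = k" using assms by (simp add: signed_perms_def)
  then have "alternating_flag b (map uminus w) \<longleftrightarrow> alternating_on b (\<lambda>i. - flag_label w i) {..<length w}"
    unfolding alternating_flag_def using flag_label_uminus[OF assms]
    by (auto intro!: alternating_on_cong)
  then show ?thesis by (simp add: alternating_on_uminus alternating_flag_def)
qed

text \<open>Exchanging neighbouring entries changes only the one prefix that separates them: shorter
  prefixes contain neither, longer ones both. The sign change happens at the last entry, which lies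
  only in the full prefix.\<close>

lemma flag_label_swap_flag:
  assumes "i < length w" "p < length w" "p \<noteq> i"
  shows "flag_label (fst (swap_flag (w, i))) p = flag_label w p"
proof (cases "p < i")
  case True
  then show ?thesis by (simp add: flag_label_def swap_flag_def)
next
  case False
  then have *: "Suc i < length w" "Suc i < Suc p" using assms by auto
  have "take (Suc p) (w[i := w ! Suc i, Suc i := w ! i]) =
      (take (Suc p) w)[i := take (Suc p) w ! Suc i, Suc i := take (Suc p) w ! i]"
    using * by (simp add: take_update_swap)
  then have "set (take (Suc p) (w[i := w ! Suc i, Suc i := w ! i])) = set (take (Suc p) w)"
    using * assms set_swap[of i "take (Suc p) w" "Suc i"] by simp
  then show ?thesis using * by (simp add: flag_label_def swap_flag_def)
qed

lemma swap_flag_involution: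
  assumes "i < length w"
  shows "swap_flag (swap_flag (w, i)) = (w, i)"
  using assms by (auto simp: swap_flag_def nth_list_update intro!: nth_equalityI)

lemma swap_flag_neq:
  assumes "w \<in> signed_perms k" "i < k"
  shows "swap_flag (w, i) \<noteq> (w, i)"
proof
  have len: "length w = k" using assms by (simp add: signed_perms_def)
  assume eq: "swap_flag (w, i) = (w, i)"
  show False
  proof (cases "Suc i < k")
    case True
    with eq len have "w[i := w ! Suc i, Suc i := w ! i] ! i = w ! i" by (simp add: swap_flag_def)
    then have "w ! Suc i = w ! i" using True len by simp
    moreover have "distinct w" using signed_perms_distinct[OF assms(1)] by (simp add: distinct_map)
    ultimately show False using True len by (simp add: nth_eq_iff_index_eq)
  next
    case False
    with eq len have "w[i := - w ! i] ! i = w ! i" by (simp add: swap_flag_def)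
    then show False using signed_perms_nth_nonzero[OF assms] assms(2) len by simp
  qed
qed

lemma swap_flag_signed_perms:
  assumes "w \<in> signed_perms k" "i < k"
  shows "fst (swap_flag (w, i)) \<in> signed_perms k"
proof -
  have len: "length w = k" using assms by (simp add: signed_perms_def)
  show ?thesis
  proof (cases "Suc i < k")
    case True
    then have "set (w[i := w ! Suc i, Suc i := w ! i]) = set w"
      using len by (intro set_swap) auto
    then show ?thesis using assms True len by (simp add: swap_flag_def signed_perms_def)
  next
    case False
    have "map abs (w[i := - w ! i]) = map abs w"
      using assms len by (intro nth_equalityI) (auto simp: nth_list_update)
    then have "abs ` set (w[i := - w ! i]) = abs ` set w"
      by (metis set_map)
    then show ?thesis using assms False len by (simp add: swap_flag_def signed_perms_def)
  qed
qed

text \<open>Double counting of the positive alternating facets in the hemisphere \<open>H\<close>: interior facets come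
  in pairs, boundary facets are the flags of the equator.\<close>

lemma odd_card_alternating_half_flags:
  assumes "Suc j \<le> n"
  defines "H \<equiv> {w \<in> signed_perms (Suc j). int (Suc j) \<in> set w}"
  shows "odd (card {w\<in>H. alternating_flag True w \<noteq> alternating_flag False w}) \<longleftrightarrow>
         odd (card {v \<in> signed_perms j. alternating_flag True v})"
proof -
  define F where "F w = {i\<in>{..<Suc j}. alternating_on True (flag_label w) ({..<Suc j} - {i})}" for w
  define Q where "Q = Sigma H F"
  \<comment> \<open>\<open>Q\<close> consists of the incidences of flags in \<open>H\<close> with
    positive alternating facets. \<open>R\<close> collects the boundary facets: there
    \<open>swap_flag\<close> would turn \<open>int (Suc j)\<close> into its negative and leave
    \<open>H\<close>.\<close>
  define R where "R = {(w, i) \<in> Q. i = j \<and> w ! j = int (Suc j)}"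
  have finH: "finite H" unfolding H_def using finite_signed_perms by simp
  have finF: "finite (F w)" for w by (simp add: F_def)
  have finQ: "finite Q" unfolding Q_def using finH finF by blast
  have RQ: "R \<subseteq> Q" by (auto simp: R_def)
  have lenH: "length w = Suc j" if "w \<in> H" for w
    using that by (simp add: H_def signed_perms_def)
  have odd_F: "odd (card (F w)) \<longleftrightarrow> alternating_flag True w \<noteq> alternating_flag False w" if "w \<in> H" for w
  proof -
    have "flag_label w i \<noteq> - flag_label w i'" if "i \<in> {..<Suc j}" "i' \<in> {..<Suc j}" for i i'
      using flag_label_not_opposite[of w "Suc j" i i'] that \<open>w \<in> H\<close> assms(1) by (simp add: H_def)
    then show ?thesis
      using odd_card_alternating_on_deletions[of "{..<Suc j}" "flag_label w" True] lenH[OF that]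
      by (simp add: F_def alternating_flag_def)
  qed
  \<comment> \<open>First count, flag by flag: modulo 2 only the flags with an odd number of such
    facets matter.\<close>
  have "odd (card Q) \<longleftrightarrow> odd (card {w\<in>H. odd (card (F w))})"
    unfolding Q_def using finH finF by (simp add: even_sum_iff)
  also have "{w\<in>H. odd (card (F w))} = {w\<in>H. alternating_flag True w \<noteq> alternating_flag False w}"
    using odd_F by blast
  finally have Q: "odd (card Q) \<longleftrightarrow> odd (card {w\<in>H. alternating_flag True w \<noteq> alternating_flag False w})" .
  have "even (card (Q - R))"
  proof (rule even_card_involution[where f = swap_flag])
    fix x assume x: "x \<in> Q - R"
    obtain w i where wi: "x = (w, i)" by (cases x)
    have w: "w \<in> H" and i: "i < Suc j"
      and alt: "alternating_on True (flag_label w) ({..<Suc j} - {i})"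
      and notR: "i = j \<Longrightarrow> w ! j \<noteq> int (Suc j)"
      using x unfolding wi Q_def R_def F_def by auto
    have sp: "w \<in> signed_perms (Suc j)" and mem: "int (Suc j) \<in> set w"
      using w by (auto simp: H_def)
    note len = lenH[OF w]
    define w' where "w' = fst (swap_flag (w, i))"
    have sw: "swap_flag (w, i) = (w', i)" by (simp add: w'_def swap_flag_def)
    show "swap_flag (swap_flag x) = x"
      unfolding wi by (rule swap_flag_involution) (simp add: len i)
    show "swap_flag x \<noteq> x"
      unfolding wi by (rule swap_flag_neq[OF sp i])
    have w'sp: "w' \<in> signed_perms (Suc j)"
      unfolding w'_def by (rule swap_flag_signed_perms[OF sp i])
    have w'mem: "int (Suc j) \<in> set w'"
    proof (cases "Suc i < Suc j")
      case True
      then have "set (w[i := w ! Suc i, Suc i := w ! i]) = set w"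
        using len by (intro set_swap) auto
      then show ?thesis using True len mem by (simp add: w'_def swap_flag_def)
    next
      case False
      \<comment> \<open>The last entry changes sign here. Outside \<open>R\<close> it is not
        \<open>int (Suc j)\<close>, so that element sits at an earlier position and
        survives.\<close>
      then have ij: "i = j" using i by simp
      obtain p where p: "p < Suc j" "w ! p = int (Suc j)"
        using mem len by (metis in_set_conv_nth)
      then have "p \<noteq> i" using notR ij by auto
      then have "w' ! p = int (Suc j)" "p < length w'"
        using p False len by (auto simp: w'_def swap_flag_def)
      then show ?thesis by (metis nth_mem)
    qed
    have "w' \<in> H" using w'sp w'mem by (simp add: H_def)
    moreover have "alternating_on True (flag_label w') ({..<Suc j} - {i})"
    proof -
      have "flag_label w' p = flag_label w p" if "p \<in> {..<Suc j} - {i}" for p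
        unfolding w'_def using flag_label_swap_flag[of i w p] that i len by simp
      then show ?thesis using alt alternating_on_cong by blast
    qed
    moreover have "w' ! j \<noteq> int (Suc j)" if "i = j"
    proof -
      have "w' ! j = - w ! j" using that len by (simp add: w'_def swap_flag_def)
      moreover have "w ! j \<noteq> - int (Suc j)"
      proof
        assume neg: "w ! j = - int (Suc j)"
        have "inj_on abs (set w)" using signed_perms_distinct[OF sp] by (simp add: distinct_map)
        then have "w ! j = int (Suc j)"
          by (rule inj_onD) (simp add: neg, simp add: len, rule mem)
        then show False using notR that by blast
      qed
      ultimately show ?thesis by linarith
    qed
    ultimately show "swap_flag x \<in> Q - R"
      using i unfolding wi sw Q_def R_def F_def by auto
  qed (simp add: finQ)
  moreover have "card Q = card R + card (Q - R)"
    using RQ finQ by (simp add: card_Diff_subset finite_subset card_mono)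
  ultimately have "odd (card Q) \<longleftrightarrow> odd (card R)"
    by simp
  \<comment> \<open>Second count: dropping the last entry, always \<open>int (Suc j)\<close> on
    \<open>R\<close>, gives a bijection with the flags of the equator.\<close>
  also have "card R = card {v \<in> signed_perms j. alternating_flag True v}"
  proof (rule bij_betw_same_card[symmetric], rule bij_betw_byWitness)
    let ?V = "{v \<in> signed_perms j. alternating_flag True v}"
    let ?f = "\<lambda>v. (v @ [int (Suc j)], j)" and ?g = "\<lambda>x. take j (fst x) :: int list"
    have lenV: "length v = j" if "v \<in> signed_perms j" for v
      using that by (simp add: signed_perms_def)
    have facet: "alternating_on True (flag_label (v @ [int (Suc j)])) ({..<Suc j} - {j}) \<longleftrightarrow>
        alternating_flag True v" if "v \<in> signed_perms j" for v
    proof -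
      have "{..<Suc j} - {j} = {..<j}" by auto
      moreover have "flag_label (v @ [int (Suc j)]) p = flag_label v p" if "p < j" for p
        using that lenV[OF \<open>v \<in> signed_perms j\<close>] by (simp add: flag_label_def)
      ultimately show ?thesis
        unfolding alternating_flag_def lenV[OF that]
        by (metis (no_types, lifting) alternating_on_cong lessThan_iff)
    qed
    show "\<forall>v\<in>?V. ?g (?f v) = v" using lenV by simp
    show "\<forall>x\<in>R. ?f (?g x) = x"
    proof
      fix x assume "x \<in> R"
      then obtain w where w: "x = (w, j)" "w \<in> signed_perms (Suc j)" "w ! j = int (Suc j)"
        unfolding R_def Q_def H_def by blast
      then show "?f (?g x) = x" using signed_perms_take(2)[OF w(2,3)] by simp
    qed
    show "?f ` ?V \<subseteq> R"
      using facet signed_perms_append lenV unfolding R_def Q_def H_def F_def by (auto simp: nth_append)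
    show "?g ` R \<subseteq> ?V"
    proof
      fix v assume "v \<in> ?g ` R"
      then obtain w where w: "v = take j w" "w \<in> signed_perms (Suc j)" "w ! j = int (Suc j)"
        "alternating_on True (flag_label w) ({..<Suc j} - {j})"
        unfolding R_def Q_def H_def F_def by auto
      then show "v \<in> ?V"
        using signed_perms_take[OF w(2,3)] facet[of v] by auto
    qed
  qed
  finally show ?thesis using Q by blast
qed

text \<open>Negation carries the positive alternating flags outside \<open>H\<close> to the negative
  alternating ones inside. The total is therefore the number of flags in \<open>H\<close>
  alternating in either sense, whose parity is that of the equator. The induction starts from the
  empty flag.\<close>

theorem odd_card_alternating_flags:
  "k \<le> n \<Longrightarrow> odd (card {w \<in> signed_perms k. alternating_flag True w})"
proof (induction k)
  case 0
  have "{w \<in> signed_perms 0. alternating_flag True w} = {[]}"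
    by (auto simp: signed_perms_def alternating_flag_def alternating_on_def)
  then show ?case by simp
next
  case (Suc j)
  let ?W = "signed_perms (Suc j)"
  define H where "H = {w \<in> ?W. int (Suc j) \<in> set w}"
  define P where "P b = {w\<in>H. alternating_flag b w}" for b
  define N where "N = {w\<in>?W. - int (Suc j) \<in> set w \<and> alternating_flag True w}"
  have fin: "finite (P b)" "finite N" for b
    unfolding P_def H_def N_def using finite_signed_perms by auto
  have "card N = card (P False)"
  proof (rule bij_betw_same_card, rule bij_betw_byWitness)
    have *: "map uminus w \<in> ?W" "alternating_flag b (map uminus w) \<longleftrightarrow> alternating_flag (\<not> b) w"
      if "w \<in> ?W" for w b
      using map_uminus_signed_perms[OF that] alternating_flag_uminus[OF that Suc.prems] by auto
    show "map uminus ` N \<subseteq> P False" "map uminus ` P False \<subseteq> N"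
      using * unfolding N_def P_def H_def by force+
  qed (simp_all add: comp_def)
  have sign: "int (Suc j) \<in> set w \<longleftrightarrow> - int (Suc j) \<notin> set w" if "w \<in> ?W" for w
  proof -
    have "int (Suc j) \<in> abs ` set w" using that by (simp add: signed_perms_def)
    then have "int (Suc j) \<in> set w \<or> - int (Suc j) \<in> set w"
      by (metis abs_if add.inverse_inverse image_iff)
    moreover have "inj_on abs (set w)"
      using signed_perms_distinct[OF that] by (simp add: distinct_map)
    ultimately show ?thesis
      by (auto dest: inj_onD[of abs "set w" "int (Suc j)" "- int (Suc j)"])
  qed
  have not_both: "\<not> (alternating_flag True w \<and> alternating_flag False w)" if "w \<in> H" for w
  proof -
    have "length w = Suc j" using that by (simp add: H_def signed_perms_def)
    then have "flag_label w ` {..<length w} \<noteq> {}" by auto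
    then show ?thesis
      unfolding alternating_flag_def alternating_on_def by (metis alternating_sign_unique)
  qed
  have "{w \<in> ?W. alternating_flag True w} = P True \<union> N" "P True \<inter> N = {}"
    using sign unfolding P_def H_def N_def by auto
  then have "card {w \<in> ?W. alternating_flag True w} = card (P True) + card (P False)"
    using fin \<open>card N = card (P False)\<close> by (simp add: card_Un_disjoint)
  also have "\<dots> = card (P True \<union> P False)"
  proof -
    have "P True \<inter> P False = {}" unfolding P_def using not_both by blast
    then show ?thesis using fin by (simp add: card_Un_disjoint)
  qed
  also have "P True \<union> P False = {w\<in>H. alternating_flag True w \<noteq> alternating_flag False w}"
    unfolding P_def using not_both by blast
  finally show ?case
    using odd_card_alternating_half_flags[OF Suc.prems] Suc unfolding H_def by simp
qed

theorem tucker: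
  assumes "\<And>X. X \<in> signed_sets n \<Longrightarrow> \<bar>lam X\<bar> \<le> int m"
  shows "n \<le> m"
proof -
  \<comment> \<open>An odd count is not zero. The \<open>n\<close> labels of such a flag have
    distinct nonzero absolute values, all at most \<open>m\<close>.\<close>
  obtain w where w: "w \<in> signed_perms n" "alternating_flag True w"
    using odd_card_alternating_flags[of n] by (metis (no_types, lifting) Collect_empty_eq card.empty even_zero order_refl)
  then have len: "length w = n" by (simp add: signed_perms_def)
  let ?L = "flag_label w ` {..<n}"
  have alt: "inj_on (flag_label w) {..<n}" "inj_on abs ?L" "0 \<notin> ?L"
    using w(2) len unfolding alternating_flag_def alternating_on_def alternating_def by auto
  then have "card (abs ` ?L) = n" by (simp add: card_image)
  moreover have "abs ` ?L \<subseteq> {1..int m}"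
    using alt(3) assms signed_perms_prefix[OF w(1)] unfolding flag_label_def by force
  ultimately show ?thesis
    using card_mono[of "{1..int m}" "abs ` ?L"] by simp
qed

end

section \<open>Schrijver's theorem\<close>

lemma alternating_delete_max:
  assumes "alternating b (insert x L)" "\<And>y. y \<in> L \<Longrightarrow> \<bar>y\<bar> < \<bar>x\<bar>"
  shows "alternating b L"
proof -
  have "z > 0 \<longleftrightarrow> (b \<longleftrightarrow> even (card {y\<in>L. \<bar>y\<bar> < \<bar>z\<bar>}))" if "z \<in> L" for z
  proof -
    have "{y \<in> insert x L. \<bar>y\<bar> < \<bar>z\<bar>} = {y\<in>L. \<bar>y\<bar> < \<bar>z\<bar>}"
      using assms(2)[OF that] by auto
    moreover have "z > 0 \<longleftrightarrow> (b \<longleftrightarrow> even (card {y \<in> insert x L. \<bar>y\<bar> < \<bar>z\<bar>}))"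
      using assms(1) that unfolding alternating_def by blast
    ultimately show ?thesis by (simp only:)
  qed
  moreover have "0 \<notin> L" "inj_on abs L"
    using assms(1) unfolding alternating_def by auto
  ultimately show ?thesis unfolding alternating_def by blast
qed

text \<open>Discarding the element of largest absolute value changes no other rank, so initial
  segments of every length are available.\<close>

lemma alternating_subset_card:
  assumes "finite L" "alternating b L" "j \<le> card L"
  shows "\<exists>M\<subseteq>L. alternating b M \<and> card M = j"
  using assms
proof (induction rule: finite_ranking_induct[where f = "abs :: int \<Rightarrow> int"])
  case (insert x S)
  show ?case
  proof (cases "x \<in> S \<or> j = card (insert x S)")
    case True
    then show ?thesis using insert by (metis insert_absorb order_refl)
  next
    case False
    have "\<bar>y\<bar> < \<bar>x\<bar>" if "y \<in> S" for y
    proof -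
      have "\<bar>y\<bar> \<noteq> \<bar>x\<bar>"
        using that False insert.prems(1) by (auto simp: alternating_def inj_on_def)
      with insert.hyps(2)[OF that] show ?thesis by simp
    qed
    then have "alternating b S" using alternating_delete_max insert.prems(1) by blast
    moreover have "card (insert x S) = Suc (card S)" using False insert.hyps(1) by simp
    then have "j \<le> card S" using False insert.prems(2) by (metis le_Suc_eq)
    ultimately show ?thesis using insert.IH by blast
  qed
qed auto

text \<open>Consecutive signs cancel in pairs. For \<open>2 * m\<close> elements this gives exactly
  \<open>m\<close> of each sign.\<close>

lemma alternating_balance:
  assumes "finite L" "alternating b L"
  shows "int (card {x\<in>L. x > 0}) - int (card {x\<in>L. x < 0}) =
         (if even (card L) then 0 else if b then 1 else -1)"
  using assms
proof (induction arbitrary: b rule: finite_ranking_induct[where f = "\<lambda>x::int. - \<bar>x\<bar>"])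
  case (insert x S)
  show ?case
  proof (cases "x \<in> S")
    case True
    then show ?thesis using insert by (simp add: insert_absorb)
  next
    case False
    have "\<bar>x\<bar> < \<bar>y\<bar>" if "y \<in> S" for y
    proof -
      have "\<bar>y\<bar> \<noteq> \<bar>x\<bar>"
        using that False insert.prems(1) by (auto simp: alternating_def inj_on_def)
      with insert.hyps(2)[OF that] show ?thesis by simp
    qed
    then have x: "x \<noteq> 0" "x > 0 \<longleftrightarrow> b" "alternating (\<not> b) S"
      using alternating_insert_min[OF insert.hyps(1)] insert.prems by auto
    have "{y \<in> insert x S. y > 0} = (if x > 0 then insert x {y\<in>S. y > 0} else {y\<in>S. y > 0})"
      "{y \<in> insert x S. y < 0} = (if x > 0 then {y\<in>S. y < 0} else insert x {y\<in>S. y < 0})"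
      using x(1) by auto
    then have "card {y \<in> insert x S. y > 0} = (if b then 1 else 0) + card {y\<in>S. y > 0}"
      "card {y \<in> insert x S. y < 0} = (if b then 0 else 1) + card {y\<in>S. y < 0}"
      using x(2) False insert.hyps(1) by simp_all
    moreover have "card (insert x S) = Suc (card S)" using False insert.hyps(1) by simp
    ultimately show ?thesis using insert.IH[OF x(3)] by (cases b) (simp_all del: insert_iff split: if_splits)
  qed
qed simp

text \<open>With nothing in between, the two ranks would differ by one and the signs would differ.
  This yields the lower bound 2 in stability.\<close>

lemma alternating_between:
  assumes "finite L" "alternating b L" "x \<in> L" "y \<in> L" "\<bar>x\<bar> < \<bar>y\<bar>" "x > 0 \<longleftrightarrow> y > 0"
  shows "\<exists>z\<in>L. \<bar>x\<bar> < \<bar>z\<bar> \<and> \<bar>z\<bar> < \<bar>y\<bar>"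
proof (rule ccontr)
  assume none: "\<not> ?thesis"
  have "{z\<in>L. \<bar>z\<bar> < \<bar>y\<bar>} = insert x {z\<in>L. \<bar>z\<bar> < \<bar>x\<bar>}"
  proof (intro equalityI subsetI)
    fix z assume z: "z \<in> {z\<in>L. \<bar>z\<bar> < \<bar>y\<bar>}"
    then have "\<bar>z\<bar> < \<bar>x\<bar> \<or> \<bar>z\<bar> = \<bar>x\<bar>" using none by force
    then show "z \<in> insert x {z\<in>L. \<bar>z\<bar> < \<bar>x\<bar>}"
      using z assms(2,3) unfolding alternating_def inj_on_def by blast
  qed (use assms in auto)
  then have "card {z\<in>L. \<bar>z\<bar> < \<bar>y\<bar>} = Suc (card {z\<in>L. \<bar>z\<bar> < \<bar>x\<bar>})"
    using assms(1) by simp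
  moreover have "x > 0 \<longleftrightarrow> (b \<longleftrightarrow> even (card {z\<in>L. \<bar>z\<bar> < \<bar>x\<bar>}))"
    "y > 0 \<longleftrightarrow> (b \<longleftrightarrow> even (card {z\<in>L. \<bar>z\<bar> < \<bar>y\<bar>}))"
    using assms(2,3,4) unfolding alternating_def by blast+
  ultimately show False using assms(6) by (cases b) simp_all
qed

text \<open>The ends have ranks 0 and \<open>card L - 1\<close>, which is odd. This yields the
  cyclic part of stability: 1 and \<open>n\<close> cannot both be positive members.\<close>

lemma alternating_even_ends:
  assumes "finite L" "alternating b L" "even (card L)" "x \<in> L" "y \<in> L"
    and "\<And>z. z \<in> L \<Longrightarrow> \<bar>x\<bar> \<le> \<bar>z\<bar>" "\<And>z. z \<in> L \<Longrightarrow> \<bar>z\<bar> \<le> \<bar>y\<bar>"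
  shows "x > 0 \<longleftrightarrow> \<not> y > 0"
proof -
  have "{z\<in>L. \<bar>z\<bar> < \<bar>x\<bar>} = {}" using assms(6) by force
  moreover have "x > 0 \<longleftrightarrow> (b \<longleftrightarrow> even (card {z\<in>L. \<bar>z\<bar> < \<bar>x\<bar>}))"
    using assms(2,4) unfolding alternating_def by blast
  ultimately have x: "x > 0 \<longleftrightarrow> b" by (simp only: card.empty even_zero simp_thms)
  have "{z\<in>L. \<bar>z\<bar> < \<bar>y\<bar>} = L - {y}"
    using assms(2,5,7) unfolding alternating_def inj_on_def by (auto simp: less_le)
  then have "card {z\<in>L. \<bar>z\<bar> < \<bar>y\<bar>} = card L - 1" using assms(1,5) by simp
  moreover have "card L > 0" using assms(1,5) by (auto simp: card_gt_0_iff)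
  ultimately have "odd (card {z\<in>L. \<bar>z\<bar> < \<bar>y\<bar>})" using assms(3) by simp
  moreover have "y > 0 \<longleftrightarrow> (b \<longleftrightarrow> even (card {z\<in>L. \<bar>z\<bar> < \<bar>y\<bar>}))"
    using assms(2,5) unfolding alternating_def by blast
  ultimately show ?thesis using x by blast
qed

lemma alternating_positive_part:
  assumes alt: "alternating b L" and sub: "L \<subseteq> {- int n..int n}" and card: "card L = 2 * m"
  shows "nat ` {x\<in>L. x > 0} \<in> schrijver_verts n m"
proof -
  have fin: "finite L" using sub finite_subset by blast
  have L0: "0 \<notin> L" using alt by (simp add: alternating_def)
  have "card {x\<in>L. x > 0} + card {x\<in>L. x < 0} = card ({x\<in>L. x > 0} \<union> {x\<in>L. x < 0})"
    using fin by (subst card_Un_disjoint) auto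
  moreover have "x > 0 \<or> x < 0" if "x \<in> L" for x
    using that L0 by (metis linorder_neqE)
  then have "{x\<in>L. x > 0} \<union> {x\<in>L. x < 0} = L" by blast
  ultimately have "card {x\<in>L. x > 0} = m"
    using alternating_balance[OF fin alt] card by simp
  moreover have "inj_on nat {x\<in>L. x > 0}" by (auto simp: inj_on_def)
  ultimately have "card (nat ` {x\<in>L. x > 0}) = m" by (simp add: card_image)
  moreover have "nat ` {x\<in>L. x > 0} \<subseteq> {1..n}" using sub by force
  moreover have gap: "y - x \<ge> 2 \<and> y - x \<le> int n - 2"
    if xy: "x \<in> L" "y \<in> L" "x > 0" "x < y" for x y
  proof
    obtain z where "\<bar>x\<bar> < \<bar>z\<bar>" "\<bar>z\<bar> < \<bar>y\<bar>"
      using alternating_between[OF fin alt xy(1,2)] xy by auto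
    then show "y - x \<ge> 2" using xy by linarith
    have "y \<le> int n" using xy sub by force
    \<comment> \<open>As \<open>1 \<le> x\<close> and \<open>y \<le> int n\<close>, only this pair
      could violate the upper bound.\<close>
    moreover have "\<not> (x = 1 \<and> y = int n)"
    proof
      assume ends: "x = 1 \<and> y = int n"
      have "\<bar>x\<bar> \<le> \<bar>z\<bar>" "\<bar>z\<bar> \<le> \<bar>y\<bar>" if "z \<in> L" for z
      proof -
        have "z \<noteq> 0" "z \<in> {- int n..int n}" using that L0 sub by auto
        then show "\<bar>x\<bar> \<le> \<bar>z\<bar>" "\<bar>z\<bar> \<le> \<bar>y\<bar>" using ends by auto
      qed
      then have "x > 0 \<longleftrightarrow> \<not> y > 0"
        using alternating_even_ends[OF fin alt _ xy(1,2)] card by simp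
      then show False using xy by simp
    qed
    ultimately show "y - x \<le> int n - 2" using xy(3) by linarith
  qed
  have "stable n (nat ` {x\<in>L. x > 0})"
    unfolding stable_def
  proof (intro ballI impI)
    fix i j assume "i \<in> nat ` {x\<in>L. x > 0}" "j \<in> nat ` {x\<in>L. x > 0}" "i \<noteq> j"
    then obtain x y where "x \<in> L" "y \<in> L" "x > 0" "y > 0" "x \<noteq> y" "int i = x" "int j = y" by auto
    then show "2 \<le> \<bar>int i - int j\<bar> \<and> \<bar>int i - int j\<bar> \<le> int n - 2"
      using gap[of x y] gap[of y x] by (cases "x < y") auto
  qed
  ultimately show ?thesis unfolding schrijver_verts_def by blast
qed

text \<open>The first elements of \<open>Z\<close> and \<open>Z'\<close> have opposite signs and,
  since \<open>Y\<close> contains no opposite pair, different absolute values. The one with the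
  smaller absolute value can be put in front of the other set.\<close>

lemma alternating_extend:
  assumes fin: "finite Y" and Y: "\<And>x. x \<in> Y \<Longrightarrow> - x \<notin> Y"
    and Z: "Z \<subseteq> Y" "alternating True Z" "card Z = r"
    and Z': "Z' \<subseteq> Y" "alternating False Z'" "card Z' = r" and "r > 0"
  shows "\<exists>b. \<exists>U\<subseteq>Y. alternating b U \<and> card U = Suc r"
proof -
  have first: "\<exists>z\<in>U. (z > 0 \<longleftrightarrow> b) \<and> (\<forall>y\<in>U. \<bar>z\<bar> \<le> \<bar>y\<bar>)"
    if U: "U \<subseteq> Y" "alternating b U" "card U = r" for U b
  proof -
    have "finite U" "U \<noteq> {}" using U fin \<open>r > 0\<close> by (auto intro: finite_subset)
    then obtain z where z: "z \<in> U" "\<And>y. y \<in> U \<Longrightarrow> \<bar>z\<bar> \<le> \<bar>y\<bar>"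
      using ex_min_if_finite[of "abs ` U"] by (metis (no_types, lifting) arg_min_if_finite(1) arg_min_least)
    then have "{y\<in>U. \<bar>y\<bar> < \<bar>z\<bar>} = {}" by force
    then have "z > 0 \<longleftrightarrow> b" using U(2) z(1) unfolding alternating_def
      by (metis card.empty even_zero)
    then show ?thesis using z by blast
  qed
  have ext: "\<exists>U\<subseteq>Y. alternating (\<not> b) U \<and> card U = Suc r"
    if U: "U \<subseteq> Y" "alternating b U" "card U = r"
      and z: "z \<in> Y" "z > 0 \<longleftrightarrow> \<not> b" "z \<noteq> 0" "\<And>y. y \<in> U \<Longrightarrow> \<bar>z\<bar> < \<bar>y\<bar>" for U b z
  proof -
    have "finite U" using U fin finite_subset by blast
    then have "alternating (\<not> b) (insert z U)"
      using alternating_insert_min[of U z "\<not> b"] z U by auto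
    moreover have "card (insert z U) = Suc r" using \<open>finite U\<close> z U by force
    ultimately show ?thesis using U z by (metis insert_subset)
  qed
  obtain z where z: "z \<in> Z" "z > 0" "\<And>y. y \<in> Z \<Longrightarrow> \<bar>z\<bar> \<le> \<bar>y\<bar>"
    using first[OF Z] by blast
  obtain z' where z': "z' \<in> Z'" "\<not> z' > 0" "\<And>y. y \<in> Z' \<Longrightarrow> \<bar>z'\<bar> \<le> \<bar>y\<bar>"
    using first[OF Z'] by blast
  have "z' \<noteq> 0" using z' Z' by (auto simp: alternating_def)
  have "z' \<noteq> - z" using z z' Z Z' Y by blast
  then consider "\<bar>z\<bar> < \<bar>z'\<bar>" | "\<bar>z'\<bar> < \<bar>z\<bar>" using z(2) z'(2) by linarith
  then show ?thesis
  proof cases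
    case 1
    then have "\<bar>z\<bar> < \<bar>y\<bar>" if "y \<in> Z'" for y using z'(3)[OF that] by linarith
    then have "\<exists>U\<subseteq>Y. alternating (\<not> False) U \<and> card U = Suc r"
      using z(1,2) Z(1) by (intro ext[OF Z', of z]) auto
    then show ?thesis by blast
  next
    case 2
    then have "\<bar>z'\<bar> < \<bar>y\<bar>" if "y \<in> Z" for y using z(3)[OF that] by linarith
    then have "\<exists>U\<subseteq>Y. alternating (\<not> True) U \<and> card U = Suc r"
      using z'(1,2) Z'(1) \<open>z' \<noteq> 0\<close> by (intro ext[OF Z, of z']) auto
    then show ?thesis by blast
  qed
qed

section \<open>The colouring bound from Tucker's lemma\<close>

lemma finite_schrijver_verts: "finite (schrijver_verts n k)"
  unfolding schrijver_verts_def by (rule finite_subset[of _ "Pow {1..n}"]) auto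

theorem schrijver_coloring_bound:
  fixes f :: "nat set \<Rightarrow> nat"
  assumes m: "m \<ge> 1" "2 * m \<le> n"
    and f: "\<And>A. A \<in> schrijver_verts n m \<Longrightarrow> f A < C"
      "\<And>A B. A \<in> schrijver_verts n m \<Longrightarrow> B \<in> schrijver_verts n m \<Longrightarrow> A \<inter> B = {} \<Longrightarrow> f A \<noteq> f B"
  shows "n + 2 \<le> 2 * m + C"
proof (rule ccontr)
  assume contr: "\<not> ?thesis"
  define has where "has X b r \<longleftrightarrow> (\<exists>Z\<subseteq>X. alternating b Z \<and> card Z = r)" for X b r
  define alt where "alt X = Max {r. \<exists>b. has X b r}" for X
  define part where "part b X = {A \<in> schrijver_verts n m. (\<lambda>a. if b then int a else - int a) ` A \<subseteq> X}" for b X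
  define col where "col X = Max (f ` (part True X \<union> part False X))" for X
  \<comment> \<open>\<open>P b X\<close> says that \<open>b\<close> is an admissible sign for the
    label. Exactly one sign turns out to be admissible for each sign vector, which makes
    \<open>lam\<close> antipodal.\<close>
  define P where "P b X \<longleftrightarrow> (if alt X < 2 * m then has X b (alt X) else col X \<in> f ` part b X)" for b X
  \<comment> \<open>The first branch uses 1 to \<open>2 * m - 1\<close>. Because
    \<open>col X\<close> is never 0 in the second branch, the offset \<open>2 * m - 1\<close> makes
    the two ranges disjoint without a gap.\<close>
  define v where "v X = (if alt X < 2 * m then alt X else 2 * m - 1 + col X)" for X
  define lam where "lam X = (if P True X then int (v X) else - int (v X))" for X

  have fin: "finite X" if "X \<in> signed_sets n" for X
    using that unfolding signed_sets_def by (auto intro: finite_subset)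
  have has_mono: "has Y b r" if "has X b r" "X \<subseteq> Y" for X Y b r
    using that unfolding has_def by blast
  have fin_has: "finite {r. \<exists>b. has X b r}" if "X \<in> signed_sets n" for X
  proof (rule finite_subset)
    show "{r. \<exists>b. has X b r} \<subseteq> {..card X}"
      using card_mono[OF fin[OF that]] unfolding has_def by auto
  qed simp
  have alt_ge: "r \<le> alt X" if "X \<in> signed_sets n" "has X b r" for X b r
    unfolding alt_def using that fin_has by (intro Max_ge) auto
  have has_alt: "has X True (alt X) \<or> has X False (alt X)" if "X \<in> signed_sets n" for X
  proof -
    have "has X True 0" unfolding has_def by (intro exI[of _ "{}"]) simp
    then have "alt X \<in> {r. \<exists>b. has X b r}"
      unfolding alt_def using fin_has[OF that] by (intro Max_in) auto
    then obtain b where "has X b (alt X)" by blast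
    then show ?thesis by (cases b) auto
  qed
  have alt_pos: "alt X > 0" if X: "X \<in> signed_sets n" for X
  proof -
    obtain x where x: "x \<in> X" "x \<noteq> 0" using X unfolding signed_sets_def by blast
    then have "has X (x > 0) 1"
      unfolding has_def using alternating_insert_min[of "{}" x "x > 0"]
      by (intro exI[of _ "{x}"]) simp
    then show ?thesis using alt_ge[OF X] by fastforce
  qed
  \<comment> \<open>Two longest alternating subsets with opposite first signs could be extended to a
    longer one.\<close>
  have has_unique: "\<not> (has X True (alt X) \<and> has X False (alt X))" if X: "X \<in> signed_sets n" for X
  proof
    assume "has X True (alt X) \<and> has X False (alt X)"
    then obtain Z Z' where Z: "Z \<subseteq> X" "alternating True Z" "card Z = alt X"
      and Z': "Z' \<subseteq> X" "alternating False Z'" "card Z' = alt X"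
      unfolding has_def by blast
    have "- x \<notin> X" if "x \<in> X" for x using X that unfolding signed_sets_def by blast
    then have "\<exists>b. \<exists>U\<subseteq>X. alternating b U \<and> card U = Suc (alt X)"
      by (rule alternating_extend[OF fin[OF X] _ Z Z' alt_pos[OF X]])
    then have "\<exists>b. has X b (Suc (alt X))" unfolding has_def by blast
    then show False using alt_ge[OF X] by fastforce
  qed
  have has_uminus: "has (uminus ` X) b r \<longleftrightarrow> has X (\<not> b) r" for X b r
  proof -
    have "has (uminus ` X) b r" if has: "has X (\<not> b) r" for X b r
    proof -
      obtain Z where "Z \<subseteq> X" "alternating (\<not> b) Z" "card Z = r"
        using has unfolding has_def by (elim exE conjE)
      then show ?thesis
        unfolding has_def using alternating_uminus[of b Z]
        by (intro exI[of _ "uminus ` Z"]) (auto simp: card_image)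
    qed
    from this[of X b r] this[of "uminus ` X" "\<not> b" r] show ?thesis
      by (auto simp: image_image)
  qed
  have alt_uminus: "alt (uminus ` X) = alt X" for X
  proof -
    have "{r. \<exists>b. has (uminus ` X) b r} = {r. \<exists>b. has X b r}"
      unfolding has_uminus by (auto simp: ex_bool_eq)
    then show ?thesis unfolding alt_def by simp
  qed

  have fin_part: "finite (part b X)" for b X
    unfolding part_def using finite_schrijver_verts by simp
  have part_mono: "part b X \<subseteq> part b Y" if "X \<subseteq> Y" for X Y b
    using that unfolding part_def by blast
  have part_uminus: "part b (uminus ` X) = part (\<not> b) X" for b X
  proof -
    have "g ` A \<subseteq> uminus ` X \<longleftrightarrow> (\<lambda>a. - g a) ` A \<subseteq> X" for g :: "nat \<Rightarrow> int" and A
      by (force simp: image_subset_iff)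
    then show ?thesis unfolding part_def by (cases b) simp_all
  qed
  have col_uminus: "col (uminus ` X) = col X" for X
    unfolding col_def part_uminus by (simp add: Un_commute)
  have part_colors: "f A \<noteq> f B" if X: "X \<in> signed_sets n" "A \<in> part True X" "B \<in> part False X" for X A B
  proof -
    have "A \<inter> B = {}"
    proof (rule ccontr)
      assume "A \<inter> B \<noteq> {}"
      then obtain a where "int a \<in> X" "- int a \<in> X" using X(2,3) unfolding part_def by auto
      then show False using X(1) unfolding signed_sets_def by blast
    qed
    then show ?thesis using f(2) X(2,3) unfolding part_def by blast
  qed
  \<comment> \<open>An alternating subset of size \<open>2 * m\<close> has a stable positive part.
    The negative side follows by passing to the antipode.\<close>
  have part_nonempty: "part b X \<noteq> {}" if X: "X \<in> signed_sets n" and "\<not> alt X < 2 * m" for X b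
  proof -
    have pos: "part True X \<noteq> {}" if X: "X \<in> signed_sets n" and large: "\<not> alt X < 2 * m" for X
    proof -
      obtain c where "has X c (alt X)" using has_alt[OF X] by (elim disjE)
      then obtain Z where Z: "Z \<subseteq> X" "alternating c Z" "card Z = alt X"
        unfolding has_def by (elim exE conjE)
      moreover have "finite Z" using Z fin[OF X] finite_subset by blast
      ultimately obtain L where L: "L \<subseteq> X" "alternating c L" "card L = 2 * m"
        using alternating_subset_card[of Z c "2 * m"] large by (metis not_less order_trans)
      have "L \<subseteq> {- int n..int n}" using L X unfolding signed_sets_def by blast
      then have "nat ` {x\<in>L. x > 0} \<in> schrijver_verts n m"
        using alternating_positive_part L by blast
      moreover have "int ` nat ` {x\<in>L. x > 0} \<subseteq> X" using L by auto
      ultimately show ?thesis unfolding part_def by auto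
    qed
    show ?thesis
      using pos[OF that] pos[of "uminus ` X"] that uminus_signed_sets[OF X]
      by (cases b) (simp_all add: alt_uminus part_uminus)
  qed
  have col_in: "col X \<in> f ` part True X \<or> col X \<in> f ` part False X"
    if "X \<in> signed_sets n" "\<not> alt X < 2 * m" for X
  proof -
    have "col X \<in> f ` (part True X \<union> part False X)"
      unfolding col_def using part_nonempty[OF that] fin_part by (intro Max_in) auto
    then show ?thesis by blast
  qed
  \<comment> \<open>Both sides contain a vertex and the two vertices are disjoint, so their colours
    differ and the larger is at least 1. This is the saved label.\<close>
  have col_pos: "col X > 0" if X: "X \<in> signed_sets n" "\<not> alt X < 2 * m" for X
  proof -
    obtain A B where AB: "A \<in> part True X" "B \<in> part False X"
      using part_nonempty[OF X] by blast
    then have "f A \<le> col X" "f B \<le> col X"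
      unfolding col_def using fin_part by (auto intro!: Max_ge)
    then show ?thesis using part_colors[OF X(1) AB] by linarith
  qed
  have col_less: "col X < C" if "X \<in> signed_sets n" "\<not> alt X < 2 * m" for X
    using col_in[OF that] f(1) unfolding part_def by auto

  have P_ex: "P True X \<or> P False X" if "X \<in> signed_sets n" for X
    unfolding P_def using has_alt[OF that] col_in[OF that] by auto
  have P_unique: "\<not> (P True X \<and> P False X)" if "X \<in> signed_sets n" for X
    unfolding P_def using has_unique[OF that] part_colors[OF that] by (auto split: if_splits; metis)
  have P_uminus: "P b (uminus ` X) \<longleftrightarrow> P (\<not> b) X" for b X
    unfolding P_def alt_uminus col_uminus has_uminus part_uminus by simp
  have v_uminus: "v (uminus ` X) = v X" for X
    unfolding v_def alt_uminus col_uminus by simp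
  have v_small: "v X < 2 * m \<longleftrightarrow> alt X < 2 * m" if "X \<in> signed_sets n" for X
    unfolding v_def using col_pos[OF that] m by auto
  have v_pos: "v X > 0" if "X \<in> signed_sets n" for X
    unfolding v_def using alt_pos[OF that] col_pos[OF that] by auto
  \<comment> \<open>Equal values come from the same branch, hence from equal \<open>alt\<close> or
    equal \<open>col\<close>. A witness for the sign inside \<open>X\<close> is then also one inside
    \<open>Y\<close>.\<close>
  have P_mono: "P b Y" if "X \<in> signed_sets n" "Y \<in> signed_sets n" "X \<subseteq> Y" "v X = v Y" "P b X" for X Y b
  proof (cases "alt X < 2 * m")
    case True
    then have "alt Y < 2 * m" using v_small that by metis
    then have "alt X = alt Y" using True that(4) unfolding v_def by simp
    then show ?thesis using True that(3,5) has_mono unfolding P_def by auto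
  next
    case False
    then have "\<not> alt Y < 2 * m" using v_small that by metis
    then have "col X = col Y" using False that(4) unfolding v_def by simp
    then show ?thesis
      using False \<open>\<not> alt Y < 2 * m\<close> that(5) part_mono[OF that(3)] unfolding P_def by auto
  qed

  interpret tucker_labelling n lam
  proof
    fix X assume X: "X \<in> signed_sets n"
    show "lam (uminus ` X) = - lam X"
      unfolding lam_def P_uminus v_uminus using P_ex[OF X] P_unique[OF X] by auto
    fix Y assume Y: "Y \<in> signed_sets n" and "X \<subseteq> Y"
    then have "P True X \<longleftrightarrow> P True Y" if "v X = v Y"
      using that P_mono[OF X Y \<open>X \<subseteq> Y\<close>] P_ex[OF X] P_unique[OF Y] by blast
    then show "lam X \<noteq> - lam Y"
      unfolding lam_def using v_pos[OF X] v_pos[OF Y] by (auto split: if_splits)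
  qed
  have "n \<le> n - 1"
  proof (rule tucker)
    fix X assume X: "X \<in> signed_sets n"
    \<comment> \<open>The largest possible value is \<open>2 * m - 1 + (C - 1)\<close>, and
      \<open>contr\<close> gives \<open>2 * m + C \<le> n + 1\<close>.\<close>
    have "v X \<le> n - 1"
      unfolding v_def using col_less[OF X] contr m by auto
    then show "\<bar>lam X\<bar> \<le> int (n - 1)" unfolding lam_def by simp
  qed
  then show False using m by simp
qed

section \<open>Random Schrijver graphs\<close>

text \<open>Combine \<open>N choose t\<close> \<le> \<open>N ^ t / fact t\<close> with
  \<open>t ^ t / fact t\<close> \<le> \<open>exp t\<close>; the latter holds because the left side
  is one term of the exponential series.\<close>

lemma binomial_le_exp:
  fixes q :: real
  assumes "q > 0" "real N \<le> q * real t"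
  shows "real (N choose t) \<le> exp (real t * (1 + ln q))"
proof -
  have "real t ^ t / fact t = (\<Sum>i\<in>{t}. real t ^ i /\<^sub>R fact i)"
    by (simp add: divide_inverse mult.commute)
  also have "\<dots> \<le> exp (real t)"
    unfolding exp_def by (rule sum_le_suminf) (use summable_exp_generic[of "real t"] in auto)
  finally have t: "real t ^ t \<le> exp (real t) * fact t" by (simp add: field_simps)
  have "real (N choose t) * fact t = real ((N choose t) * fact t)" by simp
  also have "\<dots> \<le> real (N ^ t)" using binomial_fact_pow[of N t] of_nat_le_iff by blast
  also have "\<dots> \<le> (q * real t) ^ t" using assms by (simp add: power_mono)
  also have "\<dots> = q ^ t * real t ^ t" by (simp add: power_mult_distrib)
  also have "\<dots> \<le> q ^ t * (exp (real t) * fact t)"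
    using t assms(1) by (intro mult_left_mono) auto
  also have "q ^ t = exp (real t * ln q)" using assms(1) by (simp add: exp_of_nat_mult)
  also have "exp (real t * ln q) * (exp (real t) * fact t) = exp (real t * (1 + ln q)) * fact t"
    by (simp add: exp_add[symmetric] algebra_simps flip: exp_add)
  finally show ?thesis by simp
qed

lemma prob_Pi_bernoulli_all_False:
  assumes "finite E" "F \<subseteq> E" "0 \<le> p" "p \<le> 1"
  shows "measure_pmf.prob (Pi_pmf E False (\<lambda>_. bernoulli_pmf p)) {h. \<forall>e\<in>F. \<not> h e} = (1 - p) ^ card F"
proof -
  let ?B = "\<lambda>e. if e \<in> F then {False} else UNIV"
  have "{h. \<forall>e\<in>F. \<not> h e} = Pi E ?B" using assms(2) by (auto simp: Pi_def)
  then have "measure_pmf.prob (Pi_pmf E False (\<lambda>_. bernoulli_pmf p)) {h. \<forall>e\<in>F. \<not> h e} =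
      (\<Prod>e\<in>E. measure_pmf.prob (bernoulli_pmf p) (?B e))"
    using measure_Pi_pmf_Pi[OF assms(1)] by simp
  also have "\<dots> = (\<Prod>e\<in>E. if e \<in> F then 1 - p else 1)"
    using assms by (intro prod.cong) (auto simp: measure_pmf_single)
  also have "\<dots> = (1 - p) ^ card F"
    using assms(1,2) by (simp add: prod.If_cases Int_absorb1)
  finally show ?thesis .
qed

lemma card_schrijver_verts_le: "card (schrijver_verts n k) \<le> n choose k"
proof -
  have "card (schrijver_verts n k) \<le> card {A. A \<subseteq> {1..n} \<and> card A = k}"
    unfolding schrijver_verts_def by (rule card_mono) (auto intro: finite_subset[of _ "Pow {1..n}"])
  then show ?thesis by (simp add: n_subsets)
qed

section \<open>From a colouring with few colours to a missing bipartite graph\<close>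

lemma schrijver_verts_subset:
  assumes "A \<in> schrijver_verts n m" "a \<subseteq> A" "card a = k"
  shows "a \<in> schrijver_verts n k"
  using assms unfolding schrijver_verts_def stable_def by blast

text \<open>An injective colouring is proper in a loopless graph, so the \<open>LEAST\<close> in
  \<open>chromatic_number\<close> is attained. Its colouring also fits into any larger
  palette.\<close>

lemma chromatic_number_less_coloring:
  assumes "finite (verts G)" "\<And>u. {u} \<notin> edges G" "chromatic_number G < d"
  shows "\<exists>f. proper_coloring G (d - 1) f"
proof -
  obtain f where f: "bij_betw f (verts G) {0..<card (verts G)}"
    using ex_bij_betw_finite_nat[OF assms(1)] by blast
  have "proper_coloring G (card (verts G)) f"
    unfolding proper_coloring_def
  proof (intro conjI ballI impI)
    show "f ` verts G \<subseteq> {..<card (verts G)}" using f by (auto simp: bij_betw_def)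
    fix u v assume uv: "u \<in> verts G" "v \<in> verts G" "{u, v} \<in> edges G"
    then have "u \<noteq> v" using assms(2)[of u] by auto
    then show "f u \<noteq> f v" using f uv by (auto simp: bij_betw_def inj_on_def)
  qed
  then have "\<exists>c f. proper_coloring G c f" by blast
  then have "\<exists>g. proper_coloring G (chromatic_number G) g"
    unfolding chromatic_number_def by (rule LeastI_ex)
  then obtain g where g: "proper_coloring G (chromatic_number G) g" by blast
  have "{..<chromatic_number G} \<subseteq> {..<d - 1}" using assms(3) by auto
  then have "g ` verts G \<subseteq> {..<d - 1}"
    by (rule order_trans[OF conjunct1[OF g[unfolded proper_coloring_def]]])
  then have "proper_coloring G (d - 1) g"
    unfolding proper_coloring_def using conjunct2[OF g[unfolded proper_coloring_def]] by (rule conjI)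
  then show ?thesis by blast
qed

lemma schrijver_subgraph_coloring_empty_bipartite:
  assumes "k \<ge> 1" and d: "d \<ge> 2" "n + 2 = 2 * (k + l) + d"
    and t: "\<And>c. (k + l) choose k \<le> c * (d - 1) \<Longrightarrow> t \<le> c"
    and f: "proper_coloring (schrijver_verts n k, H) (d - 1) f"
  shows "\<exists>A\<in>schrijver_verts n (k + l). \<exists>B\<in>schrijver_verts n (k + l).
    \<exists>S\<subseteq>{a. a \<subseteq> A \<and> card a = k}. \<exists>T\<subseteq>{b. b \<subseteq> B \<and> card b = k}.
      A \<inter> B = {} \<and> card S = t \<and> card T = t \<and> (\<forall>a\<in>S. \<forall>b\<in>T. {a, b} \<notin> H)"
proof -
  let ?V = "schrijver_verts n (k + l)"
  define K where "K A = {a. a \<subseteq> A \<and> card a = k}" for A :: "nat set"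
  have K_sub: "K A \<subseteq> schrijver_verts n k" if "A \<in> ?V" for A
    using schrijver_verts_subset[OF that] unfolding K_def by blast
  have fV: "f ` schrijver_verts n k \<subseteq> {..<d - 1}"
    and fE: "\<And>u v. u \<in> schrijver_verts n k \<Longrightarrow> v \<in> schrijver_verts n k \<Longrightarrow> {u, v} \<in> H \<Longrightarrow> f u \<noteq> f v"
    using f unfolding proper_coloring_def verts_def edges_def by auto
  have "\<exists>y. y < d - 1 \<and> t \<le> card (f -` {y} \<inter> K A)" if A: "A \<in> ?V" for A
  proof -
    have finA: "finite A" "card A = k + l"
      using A unfolding schrijver_verts_def by (auto intro: finite_subset)
    then have cardK: "card (K A) = (k + l) choose k" "finite (K A)"
      unfolding K_def by (auto simp: n_subsets intro: finite_subset[of _ "Pow A"])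
    have "f \<in> K A \<rightarrow> {..<d - 1}" using fV K_sub[OF A] by blast
    moreover have "{..<d - 1} \<noteq> {}" using d(1) by (auto simp: lessThan_empty_iff)
    ultimately have "\<exists>y\<in>{..<d - 1}. card (K A) \<le> card (f -` {y} \<inter> K A) * card {..<d - 1}"
      using pigeonhole_card[of f "K A" "{..<d - 1}"] cardK(2) by blast
    then show ?thesis using t cardK(1) by auto
  qed
  \<comment> \<open>\<open>g A\<close> is a popular colour among the \<open>k\<close>-subsets of
    \<open>A\<close>, found by pigeonhole.\<close>
  then obtain g where g: "\<And>A. A \<in> ?V \<Longrightarrow> g A < d - 1"
    "\<And>A. A \<in> ?V \<Longrightarrow> t \<le> card (f -` {g A} \<inter> K A)"
    by metis
  have "\<exists>A\<in>?V. \<exists>B\<in>?V. A \<inter> B = {} \<and> g A = g B"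
  proof (rule ccontr)
    assume "\<not> ?thesis"
    \<comment> \<open>Otherwise \<open>g\<close> would properly colour the stable
      \<open>(k + l)\<close>-sets with \<open>d - 1\<close> colours, exactly one too few since
      \<open>n + 2 = 2 * (k + l) + d\<close>.\<close>
    then have "n + 2 \<le> 2 * (k + l) + (d - 1)"
      using g(1) assms(1) d by (intro schrijver_coloring_bound[where f = g]) auto
    then show False using d by simp
  qed
  then obtain A B where AB: "A \<in> ?V" "B \<in> ?V" "A \<inter> B = {}" "g A = g B" by blast
  obtain S where S: "S \<subseteq> f -` {g A} \<inter> K A" "card S = t"
    using obtain_subset_with_card_n[OF g(2)[OF AB(1)]] by metis
  obtain T where T: "T \<subseteq> f -` {g B} \<inter> K B" "card T = t"
    using obtain_subset_with_card_n[OF g(2)[OF AB(2)]] by metis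
  have "{a, b} \<notin> H" if "a \<in> S" "b \<in> T" for a b
  proof
    assume "{a, b} \<in> H"
    moreover have "f a = g A" "f b = g A" using that S(1) T(1) AB(4) by auto
    moreover have "a \<in> schrijver_verts n k" "b \<in> schrijver_verts n k"
      using that S(1) T(1) K_sub[OF AB(1)] K_sub[OF AB(2)] by auto
    ultimately show False using fE[of a b] by simp
  qed
  then have "A \<inter> B = {} \<and> card S = t \<and> card T = t \<and> (\<forall>a\<in>S. \<forall>b\<in>T. {a, b} \<notin> H)"
    using S T AB by blast
  moreover have "S \<subseteq> {a. a \<subseteq> A \<and> card a = k}" "T \<subseteq> {b. b \<subseteq> B \<and> card b = k}"
    using S T unfolding K_def by auto
  ultimately show ?thesis using AB(1,2) by blast
qed

text \<open>The two conditions on \<open>t\<close> characterise the ceiling of the quotient without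
  division. The first two terms of the exponent bound the number of configurations; the last bounds
  the probability \<open>(1 - p) ^ (t * t)\<close> that one of them has no edge left.\<close>

lemma prob_schrijver_chromatic_number_less:
  fixes p :: real
  assumes k: "k \<ge> 1" and d: "d \<ge> 2" "n + 2 = 2 * (k + l) + d"
    and t: "(k + l) choose k \<le> t * (d - 1)" "\<And>c. (k + l) choose k \<le> c * (d - 1) \<Longrightarrow> t \<le> c"
    and p: "0 \<le> p" "p \<le> 1"
  shows "measure_pmf.prob (random_spanning_subgraph (schrijver_graph n k) p) {G. chromatic_number G < d}
    \<le> exp (2 * real (k + l) * ln (real n) + 2 * real t * (1 + ln (real (d - 1))) - p * (real t)\<^sup>2)"
proof -
  let ?V = "schrijver_verts n k" and ?W = "schrijver_verts n (k + l)"
  define E where "E = edges (schrijver_graph n k)"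
  \<comment> \<open>A configuration in \<open>J\<close> is a pair of disjoint stable
    \<open>(k + l)\<close>-sets, each with \<open>t\<close> chosen \<open>k\<close>-subsets;
    \<open>F\<close> lists the edges between the two families.\<close>
  define D where "D A = {S. S \<subseteq> {a. a \<subseteq> A \<and> card a = k} \<and> card S = t}" for A :: "nat set"
  define Q where "Q = Sigma ?W D"
  define J where "J = {(x, y) \<in> Q \<times> Q. fst x \<inter> fst y = {}}"
  define F :: "(nat set \<times> nat set set) \<times> nat set \<times> nat set set \<Rightarrow> nat set set set"
    where "F = (\<lambda>(x, y). (\<lambda>(a, b). {a, b}) ` (snd x \<times> snd y))"
  let ?M = "Pi_pmf E False (\<lambda>_. bernoulli_pmf p)"

  have E: "E = {{A, B} | A B. A \<in> ?V \<and> B \<in> ?V \<and> A \<noteq> B \<and> A \<inter> B = {}}"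
    unfolding E_def schrijver_graph_def edges_def by simp
  have finE: "finite E"
  proof (rule finite_subset)
    show "E \<subseteq> Pow ?V" unfolding E by auto
  qed (simp add: finite_schrijver_verts)
  have finW: "finite A" "card A = k + l" if "A \<in> ?W" for A
    using that unfolding schrijver_verts_def by (auto intro: finite_subset)
  have D: "finite (D A)" "card (D A) = ((k + l) choose k) choose t" if "A \<in> ?W" for A
  proof -
    have "finite {a. a \<subseteq> A \<and> card a = k}" using finW[OF that] by simp
    then show "finite (D A)" "card (D A) = ((k + l) choose k) choose t"
      unfolding D_def using finW[OF that] by (simp_all add: n_subsets)
  qed
  have finQ: "finite Q" unfolding Q_def using finite_schrijver_verts D(1) by blast
  then have finJ: "finite J" unfolding J_def by (auto intro: finite_subset[of _ "Q \<times> Q"])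

  have FJ: "F z \<subseteq> E" "card (F z) = t * t" if "z \<in> J" for z
  proof -
    obtain A S B T where z: "z = ((A, S), (B, T))" by (metis surj_pair)
    have AB: "A \<in> ?W" "B \<in> ?W" "A \<inter> B = {}" and ST: "card S = t" "card T = t"
      and S: "\<And>a. a \<in> S \<Longrightarrow> a \<subseteq> A \<and> card a = k" and T: "\<And>b. b \<in> T \<Longrightarrow> b \<subseteq> B \<and> card b = k"
      using that unfolding z J_def Q_def D_def by auto
    \<comment> \<open>As \<open>k \<ge> 1\<close>, disjoint \<open>k\<close>-sets differ. Hence
      every pair is a genuine edge, and no edge arises from two pairs of \<open>S\<close> and
      \<open>T\<close>, so there are exactly \<open>t * t\<close> of them.\<close>
    have disj: "a \<inter> b = {} \<and> a \<noteq> b" if "a \<in> S" "b \<in> T" for a b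
    proof -
      have "a \<inter> b = {}" using S[OF that(1)] T[OF that(2)] AB(3) by blast
      moreover have "a \<noteq> {}" using S[OF that(1)] k by auto
      ultimately show ?thesis by blast
    qed
    have "a \<in> ?V" if "a \<in> S" for a using schrijver_verts_subset[OF AB(1)] S[OF that] by blast
    moreover have "b \<in> ?V" if "b \<in> T" for b using schrijver_verts_subset[OF AB(2)] T[OF that] by blast
    ultimately show "F z \<subseteq> E"
      unfolding F_def z E using disj by fastforce
    have "inj_on (\<lambda>(a, b). {a, b}) (S \<times> T)"
    proof (rule inj_onI, clarify)
      fix a b a' b' assume "a \<in> S" "b \<in> T" "a' \<in> S" "b' \<in> T" "{a, b} = {a', b'}"
      then show "a = a' \<and> b = b'" using disj[of a b'] by (auto simp: doubleton_eq_iff)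
    qed
    then show "card (F z) = t * t"
      unfolding F_def z using ST by (simp add: card_image card_cartesian_product)
  qed

  have bad: "{h. chromatic_number (?V, {e\<in>E. h e}) < d} \<subseteq> (\<Union>z\<in>J. {h. \<forall>e\<in>F z. \<not> h e})"
  proof
    fix h assume "h \<in> {h. chromatic_number (?V, {e\<in>E. h e}) < d}"
    then have "chromatic_number (?V, {e\<in>E. h e}) < d" by simp
    moreover have "{u} \<notin> edges (?V, {e\<in>E. h e})" for u
      unfolding edges_def E by (auto simp: doubleton_eq_iff)
    moreover have "finite (verts (?V, {e\<in>E. h e}))"
      unfolding verts_def by (simp add: finite_schrijver_verts)
    ultimately obtain f where "proper_coloring (?V, {e\<in>E. h e}) (d - 1) f"
      using chromatic_number_less_coloring by blast
    from schrijver_subgraph_coloring_empty_bipartite[OF k d t(2) this]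
    obtain A B S T where AB: "A \<in> ?W" "B \<in> ?W" "A \<inter> B = {}"
      and S: "S \<subseteq> {a. a \<subseteq> A \<and> card a = k}" "card S = t"
      and T: "T \<subseteq> {b. b \<subseteq> B \<and> card b = k}" "card T = t"
      and ST: "\<forall>a\<in>S. \<forall>b\<in>T. {a, b} \<notin> {e\<in>E. h e}"
      by blast
    have J: "((A, S), (B, T)) \<in> J"
      unfolding J_def Q_def D_def using AB S T by simp
    have "\<not> h e" if e: "e \<in> F ((A, S), (B, T))" for e
    proof -
      have "e \<in> E" using FJ(1)[OF J] e by blast
      moreover obtain a b where "a \<in> S" "b \<in> T" "e = {a, b}" using e unfolding F_def by auto
      ultimately show ?thesis using ST by blast
    qed
    then show "h \<in> (\<Union>z\<in>J. {h. \<forall>e\<in>F z. \<not> h e})" using J by blast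
  qed

  have "card J \<le> card Q * card Q"
  proof -
    have "card J \<le> card (Q \<times> Q)" unfolding J_def using finQ by (intro card_mono) auto
    then show ?thesis by (simp add: card_cartesian_product)
  qed
  moreover have Q: "card Q \<le> n ^ (k + l) * (((k + l) choose k) choose t)"
  proof -
    have "k + l \<le> n" using d by auto
    then have "card ?W \<le> n ^ (k + l)"
      using card_schrijver_verts_le[of n "k + l"] binomial_le_pow[of "k + l" n]
      by linarith
    moreover have "card Q = card ?W * (((k + l) choose k) choose t)"
      unfolding Q_def using D finite_schrijver_verts by simp
    ultimately show ?thesis by simp
  qed
  define c where "c = exp (real (k + l) * ln (real n) + real t * (1 + ln (real (d - 1))))"
  have "real (card Q) \<le> c"
  proof -
    have "real n > 0" using d k by auto
    then have n: "real n ^ (k + l) = exp (real (k + l) * ln (real n))"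
      by (simp add: exp_of_nat_mult del: of_nat_add)
    have "real (card Q) \<le> real n ^ (k + l) * real (((k + l) choose k) choose t)"
      using Q by (metis of_nat_le_iff of_nat_mult of_nat_power)
    also note n
    also have "real (((k + l) choose k) choose t) \<le> exp (real t * (1 + ln (real (d - 1))))"
    proof (rule binomial_le_exp)
      show "real (d - 1) > 0" using d by simp
      show "real ((k + l) choose k) \<le> real (d - 1) * real t"
        using t(1) by (metis mult.commute of_nat_le_iff of_nat_mult)
    qed
    finally show ?thesis by (simp add: c_def exp_add)
  qed
  ultimately have J: "real (card J) \<le> c * c"
  proof -
    have "real (card J) \<le> real (card Q) * real (card Q)"
      using \<open>card J \<le> card Q * card Q\<close> by (metis of_nat_le_iff of_nat_mult)
    also have "\<dots> \<le> c * c" using \<open>real (card Q) \<le> c\<close> by (intro mult_mono) (auto simp: c_def)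
    finally show ?thesis .
  qed
  have pow: "(1 - p) ^ (t * t) \<le> exp (- p * (real t)\<^sup>2)"
  proof -
    have "(1 - p) ^ (t * t) \<le> exp (- p) ^ (t * t)"
      using p exp_ge_add_one_self[of "- p"] by (intro power_mono) auto
    also have "\<dots> = exp (- p * (real t)\<^sup>2)"
      by (simp add: exp_of_nat_mult[symmetric] power2_eq_square mult.commute)
    finally show ?thesis .
  qed

  have "measure_pmf.prob (random_spanning_subgraph (schrijver_graph n k) p) {G. chromatic_number G < d}
      = measure_pmf.prob ?M {h. chromatic_number (?V, {e\<in>E. h e}) < d}"
    unfolding random_spanning_subgraph_def E_def
    by (simp add: vimage_def schrijver_graph_def verts_def)
  also have "\<dots> \<le> measure_pmf.prob ?M (\<Union>z\<in>J. {h. \<forall>e\<in>F z. \<not> h e})"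
    using bad by (intro measure_pmf.finite_measure_mono) auto
  also have "\<dots> \<le> (\<Sum>z\<in>J. measure_pmf.prob ?M {h. \<forall>e\<in>F z. \<not> h e})"
    using finJ by (intro measure_pmf.finite_measure_subadditive_finite) auto
  also have "\<dots> = (\<Sum>z\<in>J. (1 - p) ^ (t * t))"
    using prob_Pi_bernoulli_all_False[OF finE _ p] FJ by (intro sum.cong) auto
  also have "\<dots> = real (card J) * (1 - p) ^ (t * t)" by simp
  also have "\<dots> \<le> (c * c) * exp (- p * (real t)\<^sup>2)"
    using J pow p by (intro mult_mono) (auto simp: c_def)
  also have "\<dots> = exp (2 * real (k + l) * ln (real n) + 2 * real t * (1 + ln (real (d - 1))) - p * (real t)\<^sup>2)"
    unfolding c_def by (simp add: exp_add[symmetric] algebra_simps del: of_nat_add)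
  finally show ?thesis .
qed

text \<open>\<open>d\<close> and \<open>t\<close> are integer valued, so the formula for
  \<open>d\<close> involves no truncated subtraction. The proof passes to natural numbers for each
  \<open>n\<close> with \<open>d n \<ge> 2\<close> and bounds the failure probability by
  \<open>exp (x n)\<close>.\<close>

theorem theorem3:
  fixes k l :: "nat \<Rightarrow> nat" and \<rho> :: "nat \<Rightarrow> real" and d t :: "nat \<Rightarrow> int"
  assumes "\<forall>\<^sub>F n in sequentially. k n \<ge> 2"
    and "\<forall>\<^sub>F n in sequentially. 0 < \<rho> n \<and> \<rho> n \<le> 1"
    and "\<And>n. d n = int n - 2 * int (k n) - 2 * int (l n) + 2"
    and "\<forall>\<^sub>F n in sequentially. d n \<ge> 2"
    and "\<And>n. t n = \<lceil>real ((k n + l n) choose k n) / real_of_int (d n - 1)\<rceil>"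
    and "filterlim
           (\<lambda>n. 2 * real (k n + l n) * (ln (real n) + 1)
                + 2 * real_of_int (t n) * (1 + ln (real_of_int (d n - 1)))
                - \<rho> n * (real_of_int (t n))\<^sup>2)
           at_bot sequentially"
  shows "(\<lambda>n. measure_pmf.prob (random_spanning_subgraph (schrijver_graph n (k n)) (\<rho> n))
                {G. int (chromatic_number G) \<ge> d n}) \<longlonglongrightarrow> 1"
proof -
  define x where "x n = 2 * real (k n + l n) * (ln (real n) + 1)
                + 2 * real_of_int (t n) * (1 + ln (real_of_int (d n - 1)))
                - \<rho> n * (real_of_int (t n))\<^sup>2" for n
  let ?P = "\<lambda>n. measure_pmf.prob (random_spanning_subgraph (schrijver_graph n (k n)) (\<rho> n))
                {G. int (chromatic_number G) \<ge> d n}"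
  have "1 - exp (x n) \<le> ?P n" if kn: "k n \<ge> 2" and r: "0 < \<rho> n \<and> \<rho> n \<le> 1" and dn: "d n \<ge> 2" for n
  proof -
    define d' t' where "d' = nat (d n)" and "t' = nat (t n)"
    let ?N = "(k n + l n) choose k n"
    have d': "d n = int d'" "d' \<ge> 2" using dn by (auto simp: d'_def)
    have rd: "real_of_int (d n - 1) = real (d' - 1)" "real (d' - 1) > 0" using d' by auto
    have "0 \<le> real ?N / real (d' - 1)" by simp
    then have "t n \<ge> 0" unfolding assms(5) rd(1) by (metis ceiling_mono ceiling_zero)
    then have t': "t n = int t'" by (simp add: t'_def)
    have "real ?N / real (d' - 1) \<le> of_int (t n)"
      unfolding assms(5) rd(1) by (rule le_of_int_ceiling)
    then have "real ?N / real (d' - 1) \<le> real t'" by (simp add: t')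
    then have "real ?N \<le> real (t' * (d' - 1))" using rd(2) by (simp add: field_simps)
    then have t1: "?N \<le> t' * (d' - 1)" using of_nat_le_iff by blast
    have t2: "t' \<le> c" if "?N \<le> c * (d' - 1)" for c
    proof -
      have "real ?N \<le> real c * real (d' - 1)" using that by (metis of_nat_le_iff of_nat_mult)
      then have "real ?N / real (d' - 1) \<le> of_int (int c)" using rd(2) by (simp add: divide_le_eq)
      then have "t n \<le> int c" unfolding assms(5) rd(1) ceiling_le_iff .
      then show ?thesis using t' by simp
    qed
    have "n + 2 = 2 * (k n + l n) + d'" using assms(3)[of n] d' by (simp add: algebra_simps flip: of_nat_eq_iff[where 'a = int])
    then have "measure_pmf.prob (random_spanning_subgraph (schrijver_graph n (k n)) (\<rho> n)) {G. chromatic_number G < d'}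
      \<le> exp (2 * real (k n + l n) * ln (real n) + 2 * real t' * (1 + ln (real (d' - 1))) - \<rho> n * (real t')\<^sup>2)"
      using kn d'(2) t1 t2 r by (intro prob_schrijver_chromatic_number_less) auto
    \<comment> \<open>The exponents differ by the nonnegative amount
      \<open>2 * real (k n + l n)\<close>.\<close>
    also have "\<dots> \<le> exp (x n)"
      unfolding x_def rd(1) t' by (simp add: algebra_simps)
    finally have "measure_pmf.prob (random_spanning_subgraph (schrijver_graph n (k n)) (\<rho> n)) {G. chromatic_number G < d'} \<le> exp (x n)" .
    moreover have "{G. int (chromatic_number G) \<ge> d n} = UNIV - {G :: nat set graph. chromatic_number G < d'}"
      unfolding d' by auto
    ultimately show ?thesis
      using measure_pmf.prob_compl[of "{G. chromatic_number G < d'}" "random_spanning_subgraph (schrijver_graph n (k n)) (\<rho> n)"]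
      by simp
  qed
  then have lower: "\<forall>\<^sub>F n in sequentially. 1 - exp (x n) \<le> ?P n"
    using eventually_conj[OF assms(1) eventually_conj[OF assms(2) assms(4)]]
    by (auto elim!: eventually_mono)
  have "(\<lambda>n. exp (x n)) \<longlonglongrightarrow> 0"
    using filterlim_compose[OF exp_at_bot assms(6)] unfolding x_def .
  then have "(\<lambda>n. 1 - exp (x n)) \<longlonglongrightarrow> 1"
    using tendsto_diff[OF tendsto_const[of 1]] by fastforce
  then show ?thesis
    by (rule tendsto_sandwich[OF lower _ _ tendsto_const, rotated]) simp
qed

end
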